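(* Let $k\ge1$ and let $\phi=f_1f_2\ldots f_k$ be a sequence of $+$ and $-$ signs. Then every closed subset $\mathcal{X}$ of $\mathcal{W}_\phi$ is regular, i.e. $D_\phi^{-1}(\mathcal{X})$ is a regular language over $[k]$.
   Context: A permutation of length $n\ge 0$ is an arrangement $\pi=\pi_1\ldots\pi_n$ of $1,\ldots,n$. $\pi\preceq\sigma$ ($\pi$ is involved in $\sigma$) means $\pi$ is order isomorphic to a (not necessarily contiguous) subsequence of $\sigma$. A set $\mathcal{X}$ of permutations is closed if $\sigma\in\mathcal{X}$ and $\pi\preceq\sigma$ imply $\pi\in\mathcal{X}$. $[k]=\{1,\ldots,k\}$. For a sign sequence $\phi=f_1\ldots f_k$, $\mathcal{W}_\phi$ is the set of all permutations which can be written as a concatenation $\sigma_1\sigma_2\ldots\sigma_k$ of (possibly empty) segments, where $\sigma_i$ is increasing if $f_i=+$ and decreasing if $f_i=-$. For a word $c=c_1\ldots c_n\in[k]^*$, regarded as a function $c:[n]\to[k]$, $D_\phi(c)$ is the permutation of length $n$ obtained by concatenating the sets $c^{-1}(1),\ldots,c^{-1}(k)$ in this order, with the $i$th set arranged in increasing order if $f_i=+$ and in decreasing order if $f_i=-$. The image of $D_\phi:[k]^*\to\mathcal{W}_\phi$ is all of $\mathcal{W}_\phi$. A subset $\mathcal{X}$ of $\mathcal{W}_\phi$ is called regular if $D_\phi^{-1}(\mathcal{X})$ is a regular subset of $[k]^*$. *)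

theory Defs
  imports Main "HOL-Library.Sublist" "HOL-Combinatorics.Multiset_Permutations"
begin

text \<open>A permutation of length \<open>n\<close> is the list \<open>[\<pi>\<^sub>1, \<dots>, \<pi>\<^sub>n]\<close> of its values, with entries in
  \<open>{1..n}\<close>. List positions count from 0, the points of the domain \<open>{1..n}\<close> from 1.\<close>

definition perms :: "nat list set" where
  "perms = (\<Union>n. permutations_of_set {1..n})"

definition order_isomorphic :: "nat list \<Rightarrow> nat list \<Rightarrow> bool" where
  "order_isomorphic xs ys \<longleftrightarrow> length xs = length ys \<and>
     (\<forall>i<length xs. \<forall>j<length xs. xs ! i < xs ! j \<longleftrightarrow> ys ! i < ys ! j)"

definition involved :: "nat list \<Rightarrow> nat list \<Rightarrow> bool" where
  "involved \<pi> \<sigma> \<longleftrightarrow> (\<exists>\<tau>. subseq \<tau> \<sigma> \<and> order_isomorphic \<pi> \<tau>)"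

definition closed_class :: "nat list set \<Rightarrow> bool" where
  "closed_class X \<longleftrightarrow> X \<subseteq> perms \<and> (\<forall>\<sigma>\<in>X. \<forall>\<pi>\<in>perms. involved \<pi> \<sigma> \<longrightarrow> \<pi> \<in> X)"

datatype sign = Plus | Minus

fun monotone_segment :: "sign \<Rightarrow> nat list \<Rightarrow> bool" where
  "monotone_segment Plus xs = sorted_wrt (<) xs"
| "monotone_segment Minus xs = sorted_wrt (>) xs"

definition W :: "sign list \<Rightarrow> nat list set" where
  "W \<phi> = {concat ss | ss. list_all2 monotone_segment \<phi> ss \<and> concat ss \<in> perms}"

fun arrange :: "sign \<Rightarrow> nat set \<Rightarrow> nat list" where
  "arrange Plus A = sorted_list_of_set A"
| "arrange Minus A = rev (sorted_list_of_set A)"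

text \<open>\<open>fibre c i\<close> is \<open>c\<^sup>-\<^sup>1(i)\<close> for the word \<open>c\<close> read as a function on \<open>{1..length c}\<close>.\<close>

definition fibre :: "nat list \<Rightarrow> nat \<Rightarrow> nat set" where
  "fibre c i = {j \<in> {1..length c}. c ! (j - 1) = i}"

definition D :: "sign list \<Rightarrow> nat list \<Rightarrow> nat list" where
  "D \<phi> c = concat (map (\<lambda>i. arrange (\<phi> ! (i - 1)) (fibre c i)) [1..<Suc (length \<phi>)])"

text \<open>Acceptance by a deterministic finite automaton over the finite alphabet \<open>\<Sigma>\<close>. Taking the states
  to be natural numbers is no restriction, since every finite set of states embeds in \<open>nat\<close>.\<close>

definition regular_language :: "'a set \<Rightarrow> 'a list set \<Rightarrow> bool" where
  "regular_language \<Sigma> L \<longleftrightarrow> finite \<Sigma> \<and>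
     (\<exists>(Q :: nat set) (\<delta> :: nat \<Rightarrow> 'a \<Rightarrow> nat) q0 F.
        finite Q \<and> q0 \<in> Q \<and> F \<subseteq> Q \<and> (\<forall>q\<in>Q. \<forall>a\<in>\<Sigma>. \<delta> q a \<in> Q) \<and>
        L = {w \<in> lists \<Sigma>. foldl \<delta> q0 w \<in> F})"

definition regular_subset :: "sign list \<Rightarrow> nat list set \<Rightarrow> bool" where
  "regular_subset \<phi> X \<longleftrightarrow> X \<subseteq> W \<phi> \<and>
     regular_language {1..length \<phi>} {c \<in> lists {1..length \<phi>}. D \<phi> c \<in> X}"

end

theory Submission
  imports Defs "HOL-Library.Infinite_Set"
begin

text \<open>Deleting letters of a word \<open>c\<close> deletes the corresponding points of the permutation
  \<open>D \<phi> c\<close>: each letter only says to which of the \<open>k\<close> monotone segments its position is sent,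
  and closing up the gaps between the surviving positions changes no order relation
  (\<open>involved_D\<close>). So the words encoding a closed class form a language that is closed under taking
  scattered subwords, and the theorem is an instance of Haines's theorem that every such language over
  a finite alphabet is regular (\<open>subword_closed_regular\<close>).

  Haines's theorem comes from Higman's lemma: subword order over a finite alphabet has no infinite
  antichain (\<open>higman_finite_alphabet\<close>). Hence a subword-closed language is described by finitely
  many minimal forbidden words (\<open>finite_basis\<close>). To look for all of them in one pass, a finite
  automaton remembers for each forbidden word the suffix not yet matched greedily. Each of these
  suffixes belongs to a fixed finite set, and the input is rejected exactly if one of them has
  become empty.\<close>

section \<open>Higman's lemma over a finite alphabet\<close>

definition bad :: "'a set \<Rightarrow> (nat \<Rightarrow> 'a list) \<Rightarrow> bool" where
  "bad \<Sigma> f \<longleftrightarrow> (\<forall>i. f i \<in> lists \<Sigma>) \<and> (\<forall>i j. i < j \<longrightarrow> \<not> subseq (f i) (f j))"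

text \<open>Nash-Williams's choice of a counterexample: among all bad sequences continuing the terms already
  fixed, take one whose next word is as short as possible, and fix that word. The sequence of fixed
  words is bad because any two of its terms occur together in one of the chosen sequences.\<close>

lemma minimal_bad_sequence:
  assumes "bad \<Sigma> f"
  obtains g where "bad \<Sigma> g"
    and "\<And>h n. bad \<Sigma> h \<Longrightarrow> (\<And>i. i < n \<Longrightarrow> h i = g i) \<Longrightarrow> length (g n) \<le> length (h n)"
proof -
  define minimal_at where "minimal_at n f \<longleftrightarrow>
      bad \<Sigma> f \<and> (\<forall>h. bad \<Sigma> h \<and> (\<forall>i<n. h i = f i) \<longrightarrow> length (f n) \<le> length (h n))" for n f
  have shortest: "\<exists>f'. minimal_at n f' \<and> (\<forall>i<n. f' i = f i)" if "bad \<Sigma> f" for n f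
  proof -
    let ?P = "\<lambda>h. bad \<Sigma> h \<and> (\<forall>i<n. h i = f i)"
    have "?P f" using that by simp
    from ex_has_least_nat[of ?P, OF this, of "\<lambda>h. length (h n)"]
    obtain f' where least: "?P f' \<and> (\<forall>h. ?P h \<longrightarrow> length (f' n) \<le> length (h n))"
      by (rule exE)
    then have "minimal_at n f'"
      unfolding minimal_at_def by auto
    with least show ?thesis by blast
  qed
  have "\<exists>F. \<forall>n. minimal_at n (F n) \<and> (\<forall>i\<le>n. F (Suc n) i = F n i)"
  proof (rule dependent_nat_choice)
    show "\<exists>f. minimal_at 0 f"
      using shortest[OF assms] by blast
    show "\<exists>f'. minimal_at (Suc n) f' \<and> (\<forall>i\<le>n. f' i = f i)" if "minimal_at n f" for f n
      using shortest[of f "Suc n"] that by (auto simp: minimal_at_def less_Suc_eq_le)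
  qed
  then obtain F where min: "\<And>n. minimal_at n (F n)"
    and step: "\<And>n i. i \<le> n \<Longrightarrow> F (Suc n) i = F n i" by blast
  have stable: "F n i = F i i" if "i \<le> n" for i n
    using that by (induction rule: dec_induct) (auto simp: step)
  define g where "g n = F n n" for n
  show thesis
  proof (rule that)
    show "bad \<Sigma> g"
      using min stable unfolding bad_def minimal_at_def g_def
      by (metis less_imp_le_nat)
    show "length (g n) \<le> length (h n)" if "bad \<Sigma> h" "\<And>i. i < n \<Longrightarrow> h i = g i" for h n
      using min[of n] that stable unfolding minimal_at_def g_def by (metis less_imp_le_nat)
  qed
qed

text \<open>In a minimal bad sequence, infinitely many words begin with the same letter, as the alphabet is
  finite. Removing that letter from these words, and dropping the other words from the first of them
  on, leaves a bad sequence, which contradicts minimality at the place of the first shortened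
  word.\<close>

theorem higman_finite_alphabet:
  fixes f :: "nat \<Rightarrow> 'a list"
  assumes "finite \<Sigma>" and "\<And>i. f i \<in> lists \<Sigma>"
  shows "\<exists>i j. i < j \<and> subseq (f i) (f j)"
proof (rule ccontr)
  assume "\<not> ?thesis"
  then have "bad \<Sigma> f" using assms(2) by (auto simp: bad_def)
  then obtain g where bad: "bad \<Sigma> g"
    and minimal: "\<And>h n. bad \<Sigma> h \<Longrightarrow> (\<And>i. i < n \<Longrightarrow> h i = g i) \<Longrightarrow> length (g n) \<le> length (h n)"
    using minimal_bad_sequence by metis
  have not_subseq: "\<not> subseq (g i) (g j)" if "i < j" for i j
    using bad that by (auto simp: bad_def)
  have nonempty: "g i \<noteq> []" for i
    using not_subseq[of i "Suc i"] by auto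
  have over: "g i \<in> lists \<Sigma>" for i
    using bad by (auto simp: bad_def)
  have "range (\<lambda>i. hd (g i)) \<subseteq> \<Sigma>"
    using over nonempty by (force intro: hd_in_set)
  then have "finite (range (\<lambda>i. hd (g i)))"
    using assms(1) finite_subset by blast
  then obtain i0 where "infinite {i. hd (g i) = hd (g i0)}"
    using pigeonhole_infinite[of UNIV "\<lambda>i. hd (g i)"] by auto
  then obtain r :: "nat \<Rightarrow> nat" where r: "strict_mono r" "\<forall>n. r n \<in> {i. hd (g i) = hd (g i0)}"
    using infinite_enumerate by blast
  have split: "g (r n) = hd (g i0) # tl (g (r n))" for n
  proof -
    have "hd (g (r n)) = hd (g i0)" using r(2) by blast
    then show ?thesis using list.collapse[OF nonempty[of "r n"]] by simp
  qed
  let ?n = "r 0"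
  define h where "h i = (if i < ?n then g i else tl (g (r (i - ?n))))" for i
  have "bad \<Sigma> h"
    unfolding bad_def
  proof (intro conjI allI impI)
    show "h i \<in> lists \<Sigma>" for i
      using over nonempty by (auto simp: h_def dest: list.set_sel(2))
    show "\<not> subseq (h i) (h j)" if "i < j" for i j
    proof
      assume sub: "subseq (h i) (h j)"
      consider "j < ?n" | "i < ?n" "?n \<le> j" | "?n \<le> i" by linarith
      then show False
      proof cases
        case 1
        then show False using sub not_subseq[OF that] that by (simp add: h_def)
      next
        case 2
        then have "subseq (g i) (tl (g (r (j - ?n))))" using sub by (simp add: h_def)
        then have "subseq (g i) (g (r (j - ?n)))"
          using split by (metis list_emb_Cons)
        moreover have "?n \<le> r (j - ?n)"
          using r(1) by (simp add: strict_mono_less_eq)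
        ultimately show False using not_subseq 2 by (meson less_le_trans)
      next
        case 3
        then have "subseq (tl (g (r (i - ?n)))) (tl (g (r (j - ?n))))"
          using sub that by (simp add: h_def)
        then have "subseq (g (r (i - ?n))) (g (r (j - ?n)))"
          using split by (metis subseq_Cons2)
        moreover have "r (i - ?n) < r (j - ?n)"
          using r(1) 3 that by (simp add: strict_mono_less)
        ultimately show False using not_subseq by blast
      qed
    qed
  qed
  then have "length (g ?n) \<le> length (h ?n)"
    by (rule minimal) (simp add: h_def)
  then show False
    using nonempty[of ?n] by (cases "g ?n") (auto simp: h_def)
qed

section \<open>Subword-closed languages are regular\<close>

text \<open>The words of \<open>C\<close> that are minimal in the subword order form an antichain, which is finite by
  Higman's lemma.\<close>

lemma finite_basis:
  fixes C :: "'a list set"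
  assumes "finite \<Sigma>" and "C \<subseteq> lists \<Sigma>"
  obtains M where "finite M" and "M \<subseteq> C" and "\<And>w. w \<in> C \<Longrightarrow> \<exists>m\<in>M. subseq m w"
proof -
  define M where "M = {m \<in> C. \<forall>u\<in>C. subseq u m \<longrightarrow> u = m}"
  have "finite M"
  proof (rule ccontr)
    assume "infinite M"
    then obtain f :: "nat \<Rightarrow> 'a list" where f: "inj f" "range f \<subseteq> M"
      using infinite_countable_subset by blast
    then have "f i \<in> lists \<Sigma>" for i
      using assms(2) by (auto simp: M_def)
    then obtain i j where "i < j" "subseq (f i) (f j)"
      using higman_finite_alphabet[OF assms(1)] by blast
    moreover have "f i \<in> M" "f j \<in> M" using f(2) by auto
    ultimately have "f i = f j" by (auto simp: M_def)
    with f(1) \<open>i < j\<close> show False by (auto dest: injD)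
  qed
  moreover have "M \<subseteq> C" by (auto simp: M_def)
  moreover have "\<exists>m\<in>M. subseq m w" if "w \<in> C" for w
    using that
  proof (induction w rule: length_induct)
    case (1 w)
    show ?case
    proof (cases "w \<in> M")
      case False
      then obtain u where u: "u \<in> C" "subseq u w" "u \<noteq> w"
        using 1 by (auto simp: M_def)
      then have "length u < length w"
        by (metis list_emb_length nless_le subseq_same_length)
      then obtain m where "m \<in> M" "subseq m u" using 1 u by blast
      then show ?thesis using u(2) subseq_order.trans by blast
    qed auto
  qed
  ultimately show thesis by (rule that)
qed

text \<open>The part of a pattern that is still to be found as a subword after reading one letter of the
  input, when every letter is matched as early as possible.\<close>

fun consume :: "'a \<Rightarrow> 'a list \<Rightarrow> 'a list" where
  "consume a [] = []"
| "consume a (b # m) = (if a = b then m else b # m)"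

lemma subseq_Cons_iff_consume: "subseq m (a # w) \<longleftrightarrow> subseq (consume a m) w"
  by (cases m) auto

lemma suffix_consume: "suffix (consume a m) m"
  by (cases m) (auto simp: suffix_ConsI)

lemma foldl_consume:
  "[] \<in> foldl (\<lambda>S a. consume a ` S) S w \<longleftrightarrow> (\<exists>m\<in>S. subseq m w)"
  by (induction w arbitrary: S) (auto simp: subseq_Cons_iff_consume dest: list_emb_Nil2)

text \<open>Lets an automaton use any type of states, so that they can be sets of words below.\<close>

lemma regular_languageI:
  fixes \<delta> :: "'q \<Rightarrow> 'a \<Rightarrow> 'q"
  assumes "finite \<Sigma>" and "finite Q" and "q0 \<in> Q"
    and closed: "\<And>q a. q \<in> Q \<Longrightarrow> a \<in> \<Sigma> \<Longrightarrow> \<delta> q a \<in> Q"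
    and L: "L = {w \<in> lists \<Sigma>. P (foldl \<delta> q0 w)}"
  shows "regular_language \<Sigma> L"
proof -
  obtain e :: "'q \<Rightarrow> nat" where e: "inj_on e Q"
    using finite_imp_inj_to_nat_seg[OF assms(2)] by blast
  define \<delta>' where "\<delta>' n a = e (\<delta> (inv_into Q e n) a)" for n a
  have run: "foldl \<delta> q w \<in> Q \<and> foldl \<delta>' (e q) w = e (foldl \<delta> q w)"
    if "w \<in> lists \<Sigma>" "q \<in> Q" for w q
    using that by (induction w arbitrary: q) (auto simp: closed \<delta>'_def e)
  have "L = {w \<in> lists \<Sigma>. foldl \<delta>' (e q0) w \<in> e ` {q \<in> Q. P q}}"
    unfolding L using run[OF _ assms(3)] inj_on_eq_iff[OF e] by fastforce
  moreover have "\<forall>n\<in>e ` Q. \<forall>a\<in>\<Sigma>. \<delta>' n a \<in> e ` Q"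
    by (auto simp: \<delta>'_def e closed)
  ultimately show ?thesis
    unfolding regular_language_def using assms(1,2,3)
    by (intro conjI exI[of _ "e ` Q"] exI[of _ \<delta>'] exI[of _ "e q0"] exI[of _ "e ` {q \<in> Q. P q}"])
      auto
qed

text \<open>The automaton starts from the set of minimal forbidden words and updates all of them at once;
  its states are sets of suffixes of forbidden words, of which there are finitely many.\<close>

theorem subword_closed_regular:
  assumes "finite \<Sigma>" and "L \<subseteq> lists \<Sigma>"
    and closed: "\<And>u w. w \<in> L \<Longrightarrow> subseq u w \<Longrightarrow> u \<in> L"
  shows "regular_language \<Sigma> L"
proof -
  obtain M where M: "finite M" "M \<subseteq> lists \<Sigma> - L"
    "\<And>w. w \<in> lists \<Sigma> - L \<Longrightarrow> \<exists>m\<in>M. subseq m w"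
    using finite_basis[OF assms(1), of "lists \<Sigma> - L"] by blast
  have L: "L = {w \<in> lists \<Sigma>. \<not> (\<exists>m\<in>M. subseq m w)}"
    using assms(2) M closed by blast
  show ?thesis
  proof (rule regular_languageI)
    let ?Q = "Pow {s. \<exists>m\<in>M. suffix s m}"
    have "{s. \<exists>m\<in>M. suffix s m} = (\<Union>m\<in>M. set (suffixes m))" by auto
    then show "finite ?Q" using M(1) by simp
    show "M \<in> ?Q" by auto
    show "consume a ` S \<in> ?Q" if "S \<in> ?Q" for S a
      using that by (auto 0 3 intro: suffix_order.trans[OF suffix_consume])
    show "L = {w \<in> lists \<Sigma>. [] \<notin> foldl (\<lambda>S a. consume a ` S) M w}"
      by (simp only: L foldl_consume)
  qed (rule assms(1))
qed

section \<open>Deleting letters of a word deletes points of its permutation\<close>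

lemma subseq_position_embedding:
  assumes "subseq u w"
  shows "\<exists>e. strict_mono e \<and> (\<forall>j<length u. e j < length w \<and> w ! e j = u ! j)"
  using assms
proof induction
  case (list_emb_Nil w)
  show ?case by (auto intro: exI[of _ id] simp: strict_mono_def)
next
  case (list_emb_Cons u w y)
  then obtain e where "strict_mono e" "\<forall>j<length u. e j < length w \<and> w ! e j = u ! j" by blast
  then show ?case by (intro exI[of _ "\<lambda>j. Suc (e j)"]) (auto simp: strict_mono_def)
next
  case (list_emb_Cons2 x y u w)
  then obtain e where "strict_mono e" "\<forall>j<length u. e j < length w \<and> w ! e j = u ! j" by blast
  with list_emb_Cons2(1) show ?case
    by (intro exI[of _ "case_nat 0 (\<lambda>j. Suc (e j))"])
      (auto simp: strict_mono_def less_Suc_eq_0_disj nth_Cons split: nat.split)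
qed

lemma finite_fibre [simp]: "finite (fibre c i)"
  by (simp add: fibre_def)

lemma set_arrange [simp]: "finite A \<Longrightarrow> set (arrange s A) = A"
  by (cases s) auto

lemma distinct_arrange [simp]: "distinct (arrange s A)"
  by (cases s) auto

lemma set_D: "set (D \<phi> c) = {j \<in> {1..length c}. c ! (j - 1) \<in> {1..length \<phi>}}"
  by (auto simp: D_def fibre_def)

lemma distinct_D: "distinct (D \<phi> c)"
proof -
  have "distinct (concat (map (\<lambda>i. arrange (\<phi> ! (i - 1)) (fibre c i)) xs))"
    if "distinct xs" for xs
    using that by (induction xs) (auto simp: fibre_def)
  then show ?thesis unfolding D_def by simp
qed

lemma D_in_perms:
  assumes "c \<in> lists {1..length \<phi>}"
  shows "D \<phi> c \<in> perms"
proof -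
  have "set (D \<phi> c) = {1..length c}"
    using assms by (fastforce simp: set_D in_lists_conv_set)
  then show ?thesis
    using distinct_D by (auto simp: perms_def permutations_of_set_def)
qed

lemma arrange_image:
  assumes "strict_mono e" and "finite A"
  shows "arrange s (e ` A) = map e (arrange s A)"
proof -
  have "sorted_list_of_set (e ` A) = map e (sorted_list_of_set A)"
    using assms
    by (intro sorted_distinct_set_unique)
      (auto simp: sorted_map strict_mono_less_eq distinct_map strict_mono_imp_inj_on inj_on_subset)
  then show ?thesis by (cases s) (auto simp: rev_map)
qed

lemma arrange_mono:
  assumes "A \<subseteq> B" and "finite B"
  shows "subseq (arrange s A) (arrange s B)"
proof -
  have "sorted_list_of_set A = filter (\<lambda>x. x \<in> A) (sorted_list_of_set B)"
    using assms finite_subset[OF assms]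
    by (intro sorted_distinct_set_unique) (auto simp: sorted_filter[where f = id, simplified])
  then show ?thesis by (cases s) (auto simp: rev_filter)
qed

lemma subseq_concat_map:
  assumes "\<And>x. x \<in> set xs \<Longrightarrow> subseq (f x) (g x)"
  shows "subseq (concat (map f xs)) (concat (map g xs))"
  using assms by (induction xs) (auto intro: list_emb_append_mono)

text \<open>The embedding of positions carries each fibre of \<open>u\<close> into the same fibre of \<open>w\<close> and preserves
  order, so it commutes with the increasing or decreasing arrangement of a fibre. Applied to the
  entries of \<open>D \<phi> u\<close>, it therefore exhibits an order isomorphic subsequence of \<open>D \<phi> w\<close>.\<close>

lemma involved_D:
  assumes "subseq u w"
  shows "involved (D \<phi> u) (D \<phi> w)"
proof -
  obtain e0 where "strict_mono e0"
    and e0: "\<And>j. j < length u \<Longrightarrow> e0 j < length w \<and> w ! e0 j = u ! j"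
    using subseq_position_embedding[OF assms] by blast
  \<comment> \<open>Fibres consist of positions counted from 1, whereas \<open>e0\<close> counts them from 0. The value
    at 0 only serves to make \<open>e\<close> strictly monotone everywhere.\<close>
  define e where "e = case_nat 0 (\<lambda>j. Suc (e0 j))"
  have e: "strict_mono e"
    using \<open>strict_mono e0\<close> by (auto simp: e_def strict_mono_def split: nat.split)
  have fibre: "e ` fibre u i \<subseteq> fibre w i" for i
  proof
    fix x assume "x \<in> e ` fibre u i"
    then obtain j where "x = e j" "j \<in> fibre u i" by blast
    then show "x \<in> fibre w i"
      using e0[of "j - 1"] by (cases j) (auto simp: fibre_def e_def)
  qed
  have "map e (D \<phi> u)
      = concat (map (\<lambda>i. arrange (\<phi> ! (i - 1)) (e ` fibre u i)) [1..<Suc (length \<phi>)])"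
    by (simp add: D_def map_concat arrange_image[OF e] comp_def)
  then have "subseq (map e (D \<phi> u)) (D \<phi> w)"
    unfolding D_def by (simp only:) (intro subseq_concat_map arrange_mono fibre finite_fibre)
  moreover have "order_isomorphic (D \<phi> u) (map e (D \<phi> u))"
    by (simp add: order_isomorphic_def strict_mono_less[OF e])
  ultimately show ?thesis
    unfolding involved_def by blast
qed

theorem theorem3:
  fixes k :: nat and \<phi> :: "sign list" and X :: "nat list set"
  assumes "k \<ge> 1" and "length \<phi> = k"
    and "X \<subseteq> W \<phi>" and "closed_class X"
  shows "regular_subset \<phi> X"
proof -
  let ?L = "{c \<in> lists {1..length \<phi>}. D \<phi> c \<in> X}"
  have "regular_language {1..length \<phi>} ?L"
  proof (rule subword_closed_regular)
    fix u w
    assume w: "w \<in> ?L" and sub: "subseq u w"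
    then have u: "u \<in> lists {1..length \<phi>}"
      by (auto dest: list_emb_set)
    then show "u \<in> ?L"
      using w assms(4) involved_D[OF sub] D_in_perms[OF u] by (auto simp: closed_class_def)
  qed auto
  then show ?thesis
    using assms(3) by (simp add: regular_subset_def)
qed

end
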